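(* Let $f(s)=\sum_{k=0}^\infty s^kp_k$ be a (possibly defective) probability generating function, let $a>0$, and let $n\ge0$ be an integer. Then the moment condition $$\sum_{k=2}^\infty p_ka^kk^n\ln k<\infty$$ is equivalent to $$\int_0^af^{(n+2)}(a,\ldots,a,x)\,dx<\infty,$$ where the argument $a$ is repeated $n+1$ times.
   Context: A possibly defective probability generating function is a power series $f(s)=\sum_{k\ge0}p_ks^k$ with $p_k\ge0$ and $\sum_kp_k\le1$. Tail generating functions: for $v(s)=\sum_{k\ge0}v_ks^k$ with all $v_k\ge0$ and $n\ge1$, $$v^{(n)}(s_1,\ldots,s_n)=\sum_{i_1\ge0,\ldots,i_n\ge0}v_{i_1+\cdots+i_n+n-1}\,s_1^{i_1}\cdots s_n^{i_n},$$ for $s_1,\ldots,s_n\ge0$, with values in $[0,\infty]$. (Here $v^{(n)}$ with $n$ arguments denotes the tail generating function, not a derivative.) *)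

theory Defs
  imports "HOL-Analysis.Analysis"
begin

definition defective_pgf :: "real fps \<Rightarrow> bool" where
  "defective_pgf f \<longleftrightarrow>
     (\<forall>k. 0 \<le> fps_nth f k) \<and> summable (fps_nth f) \<and> (\<Sum>k. fps_nth f k) \<le> 1"

text \<open>
  The arity is the length of the argument list \<open>s\<close>, and the multi-indices range over the lists
  \<open>i\<close> of that length. The definition is meant for power series with nonnegative coefficients
  and nonempty lists of nonnegative arguments: \<^const>\<open>ennreal\<close> would truncate negative terms to
  zero. An infinite sum over \<^typ>\<open>ennreal\<close> always exists, so the value \<open>\<infinity>\<close> expresses divergence.
\<close>

definition tail_gf :: "real fps \<Rightarrow> real list \<Rightarrow> ennreal" where
  "tail_gf v s =
     (\<Sum>\<^sub>\<infinity>i\<in>{i :: nat list. length i = length s}.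
        ennreal (fps_nth v (sum_list i + length s - 1) * (\<Prod>j<length s. (s ! j) ^ (i ! j))))"

end

theory Submission
  imports Defs
begin

text \<open>
  Integrating termwise and grouping the multi-indices by their sum \<open>m\<close> turns the integral into
  a series over \<open>m\<close> with terms \<open>p\<^bsub>m + n + 1\<^esub> a\<^bsup>m + 1\<^esup> w\<^sub>m\<close>, where \<open>w\<^sub>m\<close> is the sum of
  \<open>((m - j + n) choose n) / (j + 1)\<close> over \<open>j \<le> m\<close>. The binomial is at most \<open>(m + n)\<^sup>n\<close>, and of that
  order for \<open>j \<le> m / 2\<close>, so the harmonic sum over \<open>j\<close> makes \<open>w\<^sub>m\<close> comparable to \<open>k\<^sup>n ln k\<close>
  with \<open>k = m + n + 1\<close>.
\<close>

section \<open>Rearranging nonnegative series\<close>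

text \<open>Makes Tonelli's theorem available for infinite sums. An enumeration of an infinite
  \<open>A\<close> turns both sides into the same series over the naturals.\<close>

lemma nn_integral_count_space_eq_infsum:
  fixes g :: "'a \<Rightarrow> ennreal"
  assumes "countable A"
  shows "(\<integral>\<^sup>+x. g x \<partial>count_space A) = (\<Sum>\<^sub>\<infinity>x\<in>A. g x)"
proof (cases "finite A")
  case True
  then show ?thesis by (simp add: nn_integral_count_space_finite)
next
  case False
  have bij: "bij_betw (from_nat_into A) UNIV A"
    by (rule bij_betw_from_nat_into[OF assms False])
  have "(\<Sum>\<^sub>\<infinity>x\<in>A. g x) = (\<Sum>\<^sub>\<infinity>k. g (from_nat_into A k))"
    by (rule infsum_reindex_bij_betw[OF bij, symmetric])
  also have "\<dots> = (\<Sum>k. g (from_nat_into A k))"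
    by (intro sums_unique has_sum_imp_sums has_sum_infsum nonneg_summable_on_complete) simp
  also have "\<dots> = (\<integral>\<^sup>+k. g (from_nat_into A k) \<partial>count_space UNIV)"
    by (rule nn_integral_count_space_nat[symmetric])
  also have "\<dots> = (\<integral>\<^sup>+x. g x \<partial>count_space A)"
    by (rule nn_integral_bij_count_space[OF bij])
  finally show ?thesis ..
qed

text \<open>Translates finiteness in \<open>ennreal\<close> into real summability, where shifts,
  scalings and comparison tests apply.\<close>

lemma infsum_ennreal_less_top_iff:
  fixes h :: "nat \<Rightarrow> real"
  assumes "\<And>k. 0 \<le> h k"
  shows "(\<Sum>\<^sub>\<infinity>k. ennreal (h k)) < \<infinity> \<longleftrightarrow> summable h"
proof -
  have "(\<Sum>\<^sub>\<infinity>k. ennreal (h k)) = (\<Sum>k. ennreal (h k))"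
    by (intro sums_unique has_sum_imp_sums has_sum_infsum nonneg_summable_on_complete) simp
  moreover have "(\<Sum>k. ennreal (h k)) \<noteq> top" if "summable h"
    using suminf_ennreal2[OF assms that] by simp
  ultimately show ?thesis
    using summable_suminf_not_top[OF assms] by (auto simp: top.not_eq_extremum)
qed

text \<open>For each \<open>x\<close> the indicators of \<open>{\<phi> x}\<close> at
  \<open>m\<close> add up to 1 over all \<open>m\<close>. Inserting this sum and exchanging the
  order by Tonelli leaves, for each \<open>m\<close>, a sum over one fibre.\<close>

lemma infsum_group_by_finite_fibres:
  fixes g :: "'a \<Rightarrow> ennreal" and \<phi> :: "'a \<Rightarrow> nat"
  assumes "countable A" and fin: "\<And>m. finite {x \<in> A. \<phi> x = m}"
  shows "(\<Sum>\<^sub>\<infinity>x\<in>A. g x) = (\<Sum>\<^sub>\<infinity>m. \<Sum>x\<in>{x \<in> A. \<phi> x = m}. g x)"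
proof -
  have fibre: "(\<integral>\<^sup>+x. g x * indicator {\<phi> x} m \<partial>count_space A) = (\<Sum>x\<in>{x \<in> A. \<phi> x = m}. g x)" for m
  proof -
    have "(\<integral>\<^sup>+x. g x * indicator {\<phi> x} m \<partial>count_space A) =
        (\<Sum>x\<in>{x \<in> A. \<phi> x = m}. g x * indicator {\<phi> x} m)"
      by (rule nn_integral_count_space'[OF fin]) (auto simp: indicator_def)
    also have "\<dots> = (\<Sum>x\<in>{x \<in> A. \<phi> x = m}. g x)"
      by (rule sum.cong) auto
    finally show ?thesis .
  qed
  have "(\<integral>\<^sup>+x. g x \<partial>count_space A) =
      (\<integral>\<^sup>+x. (\<integral>\<^sup>+m. g x * indicator {\<phi> x} m \<partial>count_space UNIV) \<partial>count_space A)"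
    by (simp add: nn_integral_cmult)
  also have "\<dots> = (\<integral>\<^sup>+m. (\<integral>\<^sup>+x. g x * indicator {\<phi> x} m \<partial>count_space A) \<partial>count_space UNIV)"
    by (rule nn_integral_count_space_nn_integral) auto
  finally show ?thesis
    using assms(1) by (simp add: fibre nn_integral_count_space_eq_infsum)
qed

section \<open>Multi-indices with prescribed sum\<close>

lemma finite_length_sum_list: "finite {l :: nat list. length l = r \<and> sum_list l = m}"
proof (rule finite_subset)
  show "{l :: nat list. length l = r \<and> sum_list l = m} \<subseteq> {l. set l \<subseteq> {..m} \<and> length l = r}"
    using member_le_sum_list by fastforce
  show "finite {l. set l \<subseteq> {..m} \<and> length l = r}"
    by (rule finite_lists_length_eq) simp
qed

text \<open>Removing a last entry \<open>j\<close> leaves \<open>n + 1\<close> entries with sum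
  \<open>m - j\<close>, and stars and bars counts these lists. The last entry is singled out because
  it is the exponent of the integration variable.\<close>

lemma sum_last_length_sum_list:
  fixes h :: "nat \<Rightarrow> real"
  shows "(\<Sum>i | length i = Suc (Suc n) \<and> sum_list i = m. h (last i)) =
         (\<Sum>j\<le>m. real ((m - j + n) choose n) * h j)"
proof -
  let ?S = "SIGMA j:{..m}. {l :: nat list. length l = Suc n \<and> sum_list l = m - j}"
  have "bij_betw (\<lambda>(j, l). l @ [j]) ?S {i. length i = Suc (Suc n) \<and> sum_list i = m}"
  proof (rule bij_betwI[where g = "\<lambda>i. (last i, butlast i)"])
    have split: "i \<noteq> [] \<Longrightarrow> sum_list i = sum_list (butlast i) + last i" for i :: "nat list"
      by (metis append_butlast_last_id sum_list.append sum_list.Cons sum_list.Nil add_0_right)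
    show "(\<lambda>i. (last i, butlast i)) \<in> {i. length i = Suc (Suc n) \<and> sum_list i = m} \<rightarrow> ?S"
    proof
      fix i :: "nat list"
      assume i: "i \<in> {i. length i = Suc (Suc n) \<and> sum_list i = m}"
      then have "i \<noteq> []" by auto
      with split[of i] i show "(last i, butlast i) \<in> ?S" by auto
    qed
    show "(case (last i, butlast i) of (j, l) \<Rightarrow> l @ [j]) = i"
      if "i \<in> {i. length i = Suc (Suc n) \<and> sum_list i = m}" for i
    proof -
      from that have "i \<noteq> []" by auto
      then show ?thesis by simp
    qed
  qed auto
  from sum.reindex_bij_betw[OF this, of "\<lambda>i. h (last i)"]
  have "(\<Sum>i | length i = Suc (Suc n) \<and> sum_list i = m. h (last i)) = (\<Sum>(j, l)\<in>?S. h j)"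
    by (simp add: case_prod_unfold)
  also have "\<dots> = (\<Sum>j\<le>m. \<Sum>l | length l = Suc n \<and> sum_list l = m - j. h j)"
    by (rule sum.Sigma[symmetric]) (auto simp: finite_length_sum_list)
  also have "\<dots> = (\<Sum>j\<le>m. real ((m - j + n) choose n) * h j)"
  proof (rule sum.cong[OF refl])
    fix j
    have "card {l :: nat list. length l = Suc n \<and> sum_list l = m - j} = (m - j + n) choose (m - j)"
      using card_length_sum_list[of "Suc n" "m - j"] by simp
    also have "\<dots> = (m - j + n) choose n"
      by (subst binomial_symmetric) auto
    finally show "(\<Sum>l | length l = Suc n \<and> sum_list l = m - j. h j) =
        real ((m - j + n) choose n) * h j"
      by simp
  qed
  finally show ?thesis .
qed

text \<open>Equal arguments contribute only through the total of their exponents. The second claim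
  ensures that the subtraction in the first is not truncated.\<close>

lemma prod_replicate_snoc_power:
  fixes a x :: real
  assumes "length i = Suc r"
  shows "(\<Prod>j<Suc r. ((replicate r a @ [x]) ! j) ^ (i ! j)) = a ^ (sum_list i - last i) * x ^ last i"
    and "last i \<le> sum_list i"
proof -
  define l k where "l = butlast i" and "k = last i"
  from assms have "i \<noteq> []" by auto
  then have i: "i = l @ [k]" and l: "length l = r"
    using assms by (auto simp: l_def k_def)
  have "(\<Prod>j<Suc r. ((replicate r a @ [x]) ! j) ^ (i ! j)) = (\<Prod>j<r. a ^ (l ! j)) * x ^ k"
    using l by (simp add: i nth_append)
  also have "(\<Prod>j<r. a ^ (l ! j)) = a ^ sum_list l"
    using l by (simp add: power_sum sum_list_sum_nth atLeast0LessThan)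
  finally show "(\<Prod>j<Suc r. ((replicate r a @ [x]) ! j) ^ (i ! j)) =
      a ^ (sum_list i - last i) * x ^ last i"
    by (simp add: i)
  show "last i \<le> sum_list i" by (simp add: i)
qed

section \<open>Termwise integration\<close>

lemma nn_integral_power_Icc:
  fixes a c :: real
  assumes "0 \<le> a" "0 \<le> c"
  shows "(\<integral>\<^sup>+x\<in>{0..a}. ennreal (c * x ^ k) \<partial>lborel) = ennreal (c * (a ^ Suc k / real (Suc k)))"
proof -
  have "(\<integral>\<^sup>+x. ennreal (c * x ^ k) * indicator {0..a} x \<partial>lborel) =
      ennreal (c * (a ^ Suc k / real (Suc k)) - c * (0 ^ Suc k / real (Suc k)))"
  proof (rule nn_integral_FTC_Icc)
    show "((\<lambda>x. c * (x ^ Suc k / real (Suc k))) has_real_derivative c * x ^ k) (at x)"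
      for x
    proof -
      have "((\<lambda>x. c * (x ^ Suc k / real (Suc k))) has_real_derivative
          c * (real (Suc k) * x ^ k / real (Suc k))) (at x)"
        by (rule derivative_eq_intros refl | simp)+
      then show ?thesis by simp
    qed
  qed (use assms in auto)
  then show ?thesis by simp
qed

text \<open>
  The total contribution of \<open>p\<^bsub>m + n + 1\<^esub> a\<^bsup>m + 1\<^esup>\<close> to the integral: the binomial counts the
  exponents of the \<open>n + 1\<close> arguments equal to \<open>a\<close>, and \<open>1 / (j + 1)\<close> comes from integrating \<open>x\<^sup>j\<close>.
\<close>

definition weight :: "nat \<Rightarrow> nat \<Rightarrow> real" where
  "weight n m = (\<Sum>j\<le>m. real ((m - j + n) choose n) / real (Suc j))"

lemma weight_nonneg: "0 \<le> weight n m"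
  by (auto simp: weight_def intro!: sum_nonneg)

lemma nn_integral_tail_gf:
  fixes f :: "real fps" and a :: real
  assumes f: "\<And>k. 0 \<le> fps_nth f k" and a: "0 < a"
  shows "(\<integral>\<^sup>+x\<in>{0..a}. tail_gf f (replicate (n + 1) a @ [x]) \<partial>lborel) =
         (\<Sum>\<^sub>\<infinity>m. ennreal (fps_nth f (m + n + 1) * a ^ (m + 1) * weight n m))"
proof -
  let ?L = "{i :: nat list. length i = Suc (Suc n)}"
  \<comment> \<open>\<open>?c i\<close> is the factor of the \<open>i\<close>-th term that is free
    of \<open>x\<close>, and \<open>?d i\<close> is the integral of that term over
    \<open>{0..a}\<close>. The coefficient index is \<open>sum_list i + (n + 2) - 1\<close>.\<close>
  let ?c = "\<lambda>i. fps_nth f (sum_list i + n + 1) * a ^ (sum_list i - last i)"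
  let ?d = "\<lambda>i. fps_nth f (sum_list i + n + 1) * a ^ (sum_list i + 1) * (1 / real (Suc (last i)))"
  have L: "countable ?L"
    by (rule countable_subset[OF subset_UNIV]) simp
  have tail: "tail_gf f (replicate (n + 1) a @ [x]) =
      (\<integral>\<^sup>+i. ennreal (?c i * x ^ last i) \<partial>count_space ?L)" for x
  proof -
    have "tail_gf f (replicate (n + 1) a @ [x]) = (\<Sum>\<^sub>\<infinity>i\<in>?L. ennreal (?c i * x ^ last i))"
      unfolding tail_gf_def
    proof (rule infsum_cong_neutral)
      fix i assume "i \<in> {i. length i = length (replicate (n + 1) a @ [x])} \<inter> ?L"
      then have i: "length i = Suc (Suc n)" by auto
      show "ennreal (fps_nth f (sum_list i + length (replicate (n + 1) a @ [x]) - 1) *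
          (\<Prod>j<length (replicate (n + 1) a @ [x]). (replicate (n + 1) a @ [x]) ! j ^ i ! j)) =
          ennreal (?c i * x ^ last i)"
        using prod_replicate_snoc_power(1)[OF i, of a x]
        by (simp add: mult.assoc del: replicate_Suc prod.lessThan_Suc)
    qed auto
    then show ?thesis
      by (simp add: nn_integral_count_space_eq_infsum[OF L])
  qed
  have integral_term: "(\<integral>\<^sup>+x\<in>{0..a}. ennreal (?c i * x ^ last i) \<partial>lborel) = ennreal (?d i)" if "i \<in> ?L" for i
  proof -
    from that have "last i \<le> sum_list i"
      by (auto intro: prod_replicate_snoc_power(2))
    \<comment> \<open>Integrating \<open>x ^ last i\<close> supplies exactly the missing powers of
      \<open>a\<close>, so the total power depends on \<open>i\<close> only through
      \<open>sum_list i\<close>.\<close>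
    then have "a ^ (sum_list i + 1) = a ^ (sum_list i - last i) * a ^ Suc (last i)"
      by (simp flip: power_add)
    moreover have "0 \<le> ?c i" using f a by simp
    ultimately show ?thesis
      using nn_integral_power_Icc[of a "?c i" "last i"] a by (simp add: ac_simps)
  qed
  have fibre: "(\<Sum>i\<in>{i \<in> ?L. sum_list i = m}. ennreal (?d i)) =
      ennreal (fps_nth f (m + n + 1) * a ^ (m + 1) * weight n m)" for m
  proof -
    have "(\<Sum>i\<in>{i \<in> ?L. sum_list i = m}. ennreal (?d i)) = ennreal (\<Sum>i\<in>{i \<in> ?L. sum_list i = m}. ?d i)"
      using f a by (intro sum_ennreal) auto
    also have "(\<Sum>i\<in>{i \<in> ?L. sum_list i = m}. ?d i) =
        (\<Sum>i\<in>{i \<in> ?L. sum_list i = m}. fps_nth f (m + n + 1) * a ^ (m + 1) * (1 / real (Suc (last i))))"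
      by (rule sum.cong) auto
    also have "\<dots> = fps_nth f (m + n + 1) * a ^ (m + 1) * weight n m"
      using sum_last_length_sum_list[where h = "\<lambda>j. 1 / real (Suc j)" and n = n and m = m]
      by (simp only: weight_def sum_distrib_left[symmetric]) simp
    finally show ?thesis .
  qed
  have "(\<integral>\<^sup>+x\<in>{0..a}. tail_gf f (replicate (n + 1) a @ [x]) \<partial>lborel) =
      (\<integral>\<^sup>+x. (\<integral>\<^sup>+i. ennreal (?c i * x ^ last i) * indicator {0..a} x \<partial>count_space ?L) \<partial>lborel)"
    by (simp only: tail) (simp add: nn_integral_multc)
  \<comment> \<open>Tonelli exchanges the countable sum with the integral over
    \<open>x\<close>.\<close>
  also have "\<dots> = (\<integral>\<^sup>+i. (\<integral>\<^sup>+x\<in>{0..a}. ennreal (?c i * x ^ last i) \<partial>lborel) \<partial>count_space ?L)"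
    by (rule nn_integral_count_space_nn_integral[OF L]) measurable
  also have "\<dots> = (\<integral>\<^sup>+i. ennreal (?d i) \<partial>count_space ?L)"
    by (rule nn_integral_cong) (use integral_term in simp)
  also have "\<dots> = (\<Sum>\<^sub>\<infinity>i\<in>?L. ennreal (?d i))"
    by (rule nn_integral_count_space_eq_infsum[OF L])
  also have "\<dots> = (\<Sum>\<^sub>\<infinity>m. \<Sum>i\<in>{i \<in> ?L. sum_list i = m}. ennreal (?d i))"
    by (rule infsum_group_by_finite_fibres[OF L]) (simp add: finite_length_sum_list)
  finally show ?thesis by (simp only: fibre)
qed

section \<open>Growth of the weights\<close>

text \<open>Bounding every binomial by the same power leaves a harmonic number, which is at most
  \<open>1 + ln (real (Suc m))\<close>.\<close>

lemma weight_upper: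
  assumes "2 \<le> m"
  shows "weight n m \<le> 2 * (real (m + n + 1) ^ n * ln (real (m + n + 1)))"
proof -
  let ?k = "real (m + n + 1)"
  have binom: "real ((m - j + n) choose n) \<le> ?k ^ n" for j
  proof -
    have "(m - j + n) choose n \<le> (m - j + n) ^ n"
      by (rule binomial_le_pow) simp
    also have "\<dots> \<le> (m + n + 1) ^ n"
      by (rule power_mono) auto
    finally show ?thesis
      by (metis of_nat_le_iff of_nat_power)
  qed
  have "weight n m \<le> (\<Sum>j\<le>m. ?k ^ n / real (Suc j))"
    unfolding weight_def by (intro sum_mono divide_right_mono binom) simp
  also have "\<dots> = ?k ^ n * harm (Suc m)"
    by (simp add: harm_altdef lessThan_Suc_atMost sum_distrib_left divide_inverse del: of_nat_Suc)
  also have "\<dots> \<le> ?k ^ n * (2 * ln ?k)"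
  proof (rule mult_left_mono)
    have "harm (Suc m) - ln (real (Suc m)) \<le> harm (Suc 0) - ln (real (Suc 0))"
      by (rule decseqD[OF decseq_harm_diff_ln]) simp
    then have "harm (Suc m) \<le> 1 + ln (real (Suc m))"
      by (simp add: harm_def)
    also have "ln (real (Suc m)) \<le> ln ?k"
      by (subst ln_le_cancel_iff) auto
    \<comment> \<open>Since \<open>2 \<le> m\<close>, the argument is at least 3 and hence at least
      e. This absorbs the constant 1 into the factor 2.\<close>
    also have "1 \<le> ln ?k"
      using exp_le assms by (subst ln_ge_iff) auto
    finally show "harm (Suc m) \<le> 2 * ln ?k" by simp
  qed simp
  finally show ?thesis by (simp add: algebra_simps)
qed

text \<open>The indices \<open>j \<le> m div 2\<close> suffice: there the binomials have full order,
  and the harmonic sum over half the range still grows like the logarithm.\<close>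

lemma weight_lower:
  obtains C :: real where "0 < C"
    and "\<And>m. real (m + n + 1) ^ n * ln (real (m + n + 1)) \<le> C * weight n m"
proof
  \<comment> \<open>\<open>D\<close> compares logarithms: \<open>?k\<close> is at most
    \<open>n + 2\<close> times \<open>m div 2 + 2\<close>, and \<open>ln (real (n + 2))\<close> is
    absorbed because \<open>ln (real (m div 2 + 2))\<close> is at least \<open>ln 2\<close>. The
    factor \<open>real (4 * n) ^ n\<close> comes from \<open>?k \<le> 4 * (m - j + n)\<close> and
    the bound \<open>(N / n) ^ n\<close> for N choose n; it equals 1 when
    \<open>n = 0\<close>.\<close>
  define D where "D = ln (real (n + 2)) / ln 2 + 1"
  let ?C = "real (4 * n) ^ n * D"
  have D: "0 < D" unfolding D_def by (intro add_nonneg_pos divide_nonneg_pos) auto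
  have pos: "0 < real (4 * n) ^ n" by (cases "n = 0") auto
  show "0 < ?C" using D pos by simp
  fix m
  let ?k = "real (m + n + 1)"
  have binom: "?k ^ n / real (4 * n) ^ n \<le> real ((m - j + n) choose n)" if "j \<le> m div 2" for j
  proof (cases "n = 0")
    case False
    from that have "m \<le> 2 * (m - j)" by auto
    with False have "m + n + 1 \<le> 4 * (m - j + n)" by simp
    then have "?k \<le> real (4 * (m - j + n))" by (simp only: of_nat_le_iff)
    then have "?k / real (4 * n) \<le> real (4 * (m - j + n)) / real (4 * n)"
      by (rule divide_right_mono) simp
    also have "\<dots> = real (m - j + n) / real n"
      using False by (simp add: divide_simps)
    finally have "?k / real (4 * n) \<le> real (m - j + n) / real n" .
    then have "(?k / real (4 * n)) ^ n \<le> (real (m - j + n) / real n) ^ n"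
      by (rule power_mono) simp
    also have "\<dots> \<le> real ((m - j + n) choose n)"
      by (rule binomial_ge_n_over_k_pow_k) simp
    finally show ?thesis by (simp add: power_divide)
  qed simp
  have ln: "ln ?k \<le> D * ln (real (m div 2 + 2))"
  proof -
    let ?q = "real (m div 2 + 2)"
    have "m + n + 1 \<le> 2 * (m div 2 + 2) + n * (m div 2 + 2)"
    proof -
      have "m + 1 \<le> 2 * (m div 2 + 2)" by presburger
      moreover have "n \<le> n * (m div 2 + 2)" by simp
      ultimately show ?thesis by linarith
    qed
    then have "m + n + 1 \<le> (n + 2) * (m div 2 + 2)"
      by (simp add: algebra_simps)
    then have "?k \<le> real (n + 2) * ?q"
      by (metis of_nat_le_iff of_nat_mult)
    then have "ln ?k \<le> ln (real (n + 2) * ?q)"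
      by (subst ln_le_cancel_iff) auto
    also have "\<dots> = ln (real (n + 2)) + ln ?q"
      by (rule ln_mult_pos) auto
    also have "ln (real (n + 2)) \<le> ln (real (n + 2)) / ln 2 * ln ?q"
    proof -
      have "ln (real (n + 2)) / ln 2 * ln 2 \<le> ln (real (n + 2)) / ln 2 * ln ?q"
        by (rule mult_left_mono) auto
      then show ?thesis by simp
    qed
    finally show ?thesis by (simp add: D_def algebra_simps)
  qed
  \<comment> \<open>The harmonic number of index N is at least ln (N + 1), here with
    \<open>N = m div 2 + 1\<close>.\<close>
  have "?k ^ n / real (4 * n) ^ n * ln (real (m div 2 + 2)) \<le>
      ?k ^ n / real (4 * n) ^ n * harm (Suc (m div 2))"
    using ln_le_harm[of "Suc (m div 2)"] by (intro mult_left_mono) (auto simp: add_ac)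
  also have "\<dots> = (\<Sum>j\<le>m div 2. ?k ^ n / real (4 * n) ^ n / real (Suc j))"
    by (simp add: harm_altdef lessThan_Suc_atMost sum_distrib_left divide_inverse del: of_nat_Suc)
  also have "\<dots> \<le> (\<Sum>j\<le>m div 2. real ((m - j + n) choose n) / real (Suc j))"
    using binom by (intro sum_mono divide_right_mono) auto
  also have "\<dots> \<le> weight n m"
    unfolding weight_def by (rule sum_mono2) auto
  finally have main: "?k ^ n * ln (real (m div 2 + 2)) \<le> real (4 * n) ^ n * weight n m"
    using pos by (simp add: field_simps)
  have "?k ^ n * ln ?k \<le> D * (?k ^ n * ln (real (m div 2 + 2)))"
    using mult_left_mono[OF ln, of "?k ^ n"] by (simp add: algebra_simps)
  also have "\<dots> \<le> D * (real (4 * n) ^ n * weight n m)"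
    using main D by (intro mult_left_mono) auto
  finally show "?k ^ n * ln ?k \<le> ?C * weight n m" by (simp add: algebra_simps)
qed

section \<open>Comparison of the two series\<close>

theorem theorem13:
  fixes f :: "real fps" and a :: real and n :: nat
  assumes "defective_pgf f" and "a > 0"
  shows "(\<Sum>\<^sub>\<infinity>k\<in>{2..}. ennreal (fps_nth f k * a ^ k * real k ^ n * ln (real k))) < \<infinity> \<longleftrightarrow>
         (\<integral>\<^sup>+x\<in>{0..a}. tail_gf f (replicate (n + 1) a @ [x]) \<partial>lborel) < \<infinity>"
proof -
  have f: "0 \<le> fps_nth f k" for k
    using assms(1) by (simp add: defective_pgf_def)
  let ?t = "\<lambda>k. fps_nth f k * a ^ k * real k ^ n * ln (real k)"
  let ?u = "\<lambda>m. fps_nth f (m + n + 1) * a ^ (m + 1) *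
    (real (m + n + 1) ^ n * ln (real (m + n + 1)))"
  let ?w = "\<lambda>m. fps_nth f (m + n + 1) * a ^ (m + 1) * weight n m"
  have ln_nonneg: "0 \<le> ln (real k)" for k
    by (cases "k = 0") auto
  have coeff: "0 \<le> fps_nth f (m + n + 1) * a ^ (m + 1)" for m
    using f assms(2) by simp
  \<comment> \<open>The terms at 0 and 1 vanish: \<open>ln 1 = 0\<close>, and
    \<open>ln 0 = 0\<close> by convention.\<close>
  have "(\<Sum>\<^sub>\<infinity>k\<in>{2..}. ennreal (?t k)) = (\<Sum>\<^sub>\<infinity>k. ennreal (?t k))"
  proof (rule infsum_cong_neutral)
    fix k :: nat assume "k \<in> UNIV - {2..}"
    then have "k = 0 \<or> k = 1" by auto
    then show "ennreal (?t k) = 0" by auto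
  qed auto
  moreover have "0 \<le> ?t k" for k
    using f assms(2) ln_nonneg by simp
  ultimately have "(\<Sum>\<^sub>\<infinity>k\<in>{2..}. ennreal (?t k)) < \<infinity> \<longleftrightarrow> summable ?t"
    by (simp only: infsum_ennreal_less_top_iff)
  \<comment> \<open>With \<open>k = m + n + 1\<close>, only finitely many terms are dropped, and the
    powers of \<open>a\<close> in the two series differ by the positive constant
    \<open>a ^ n\<close>.\<close>
  also have "\<dots> \<longleftrightarrow> summable (\<lambda>m. ?t (m + (n + 1)))"
    by (rule summable_iff_shift[symmetric])
  also have "(\<lambda>m. ?t (m + (n + 1))) = (\<lambda>m. a ^ n * ?u m)"
    by (auto simp: fun_eq_iff power_add algebra_simps)
  also have "summable \<dots> \<longleftrightarrow> summable ?u"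
    using assms(2) by (subst summable_cmult_iff) simp
  also have "\<dots> \<longleftrightarrow> summable ?w"
  proof
    assume u: "summable ?u"
    show "summable ?w"
    proof (rule summable_comparison_test')
      show "summable (\<lambda>m. 2 * ?u m)" using u by (rule summable_mult)
      fix m :: nat assume "2 \<le> m"
      from mult_left_mono[OF weight_upper[OF this, of n] coeff[of m]]
      show "norm (?w m) \<le> 2 * ?u m"
        using coeff[of m] weight_nonneg[of n m] by (simp add: mult.left_commute)
    qed
  next
    assume w: "summable ?w"
    obtain C where C: "0 < C"
      "\<And>m. real (m + n + 1) ^ n * ln (real (m + n + 1)) \<le> C * weight n m"
      using weight_lower[of n] by blast
    show "summable ?u"
    proof (rule summable_comparison_test')
      show "summable (\<lambda>m. C * ?w m)" using w by (rule summable_mult)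
      fix m :: nat assume "0 \<le> m"
      have "0 \<le> ?u m" by (intro mult_nonneg_nonneg[OF coeff] mult_nonneg_nonneg ln_nonneg) simp
      then show "norm (?u m) \<le> C * ?w m"
        using mult_left_mono[OF C(2)[of m] coeff[of m]]
        by (simp only: real_norm_def abs_of_nonneg mult.left_commute)
    qed
  qed
  also have "\<dots> \<longleftrightarrow> (\<Sum>\<^sub>\<infinity>m. ennreal (?w m)) < \<infinity>"
    by (intro infsum_ennreal_less_top_iff[symmetric] mult_nonneg_nonneg[OF coeff] weight_nonneg)
  finally show ?thesis
    by (simp only: nn_integral_tail_gf[OF f assms(2)])
qed

end
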